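(* Let $\phi$ be an analytic self-map of the upper half-plane $\mathbb{H}$ of parabolic type, i.e. such that $$\phi(z)\longrightarrow\infty\qquad\text{and}\qquad\frac{\phi(z)}{z}\longrightarrow 1$$ as $z\to\infty$ non-tangentially. Let $\{w_n\}_{n=0}^{\infty}\subset\mathbb{H}$ be a backward-iteration sequence for $\phi$, i.e. $\phi(w_{n+1})=w_n$ for $n=0,1,2,\dots$, with bounded pseudo-hyperbolic steps $d_n=d(w_n,w_{n+1})\uparrow a<1$, which tends to infinity. Then $$\frac{\operatorname{Im} w_{n+1}}{\operatorname{Im} w_n}\longrightarrow 1$$ as $n$ tends to infinity.
   Context: $\mathbb{H}=\{z\in\mathbb{C}:\operatorname{Im} z>0\}$, and $d(z,w)=\left|\frac{w-z}{w-\overline{z}}\right|$ is the pseudo-hyperbolic distance on $\mathbb{H}$. "$z\to\infty$ non-tangentially" means that $z\to\infty$ within a sector $\{|\operatorname{Arg} z-\pi/2|<\theta_0\}$, for each $\theta_0\in(0,\pi/2)$. The notation $d_n\uparrow a$ means that $d_n$ is non-decreasing with limit $a$. *)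

theory Defs
  imports "HOL-Complex_Analysis.Complex_Analysis"
begin

definition upper_half_plane :: "complex set" where
  "upper_half_plane = {z. Im z > 0}"

definition phyp_dist :: "complex \<Rightarrow> complex \<Rightarrow> real" where
  "phyp_dist z w = cmod ((w - z) / (w - cnj z))"

(* The library's Arg is the principal argument, with values in (-pi, pi] and Arg 0 = 0;
   for 0 < t < pi/2 the sector is therefore contained in the upper half-plane. *)
definition sector :: "real \<Rightarrow> complex set" where
  "sector t = {z. \<bar>Arg z - pi / 2\<bar> < t}"

(* The filter F is the target: nhds l for a finite limit l, at_infinity for the limit infinity.
   The rate of convergence may depend on the sector. *)
definition nontangential_limit_at_infinity ::
    "(complex \<Rightarrow> complex) \<Rightarrow> complex filter \<Rightarrow> bool" where
  "nontangential_limit_at_infinity f F \<longleftrightarrow>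
     (\<forall>t\<in>{0<..<pi / 2}. filterlim f F (inf at_infinity (principal (sector t))))"

definition parabolic_self_map :: "(complex \<Rightarrow> complex) \<Rightarrow> bool" where
  "parabolic_self_map \<phi> \<longleftrightarrow>
     \<phi> holomorphic_on upper_half_plane \<and>
     \<phi> ` upper_half_plane \<subseteq> upper_half_plane \<and>
     nontangential_limit_at_infinity \<phi> at_infinity \<and>
     nontangential_limit_at_infinity (\<lambda>z. \<phi> z / z) (nhds 1)"

definition backward_iteration_sequence ::
    "(complex \<Rightarrow> complex) \<Rightarrow> (nat \<Rightarrow> complex) \<Rightarrow> bool" where
  "backward_iteration_sequence \<phi> w \<longleftrightarrow>
     (\<forall>n. w n \<in> upper_half_plane) \<and> (\<forall>n. \<phi> (w (Suc n)) = w n)"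

end

theory Submission
  imports Defs
begin

text \<open>
  By Julia's lemma \<open>Im (\<phi> z) \<ge> Im z\<close>, so \<open>\<phi> - id\<close> also satisfies the Schwarz--Pick inequality, which
  by Cauchy--Schwarz implies the one for \<open>\<phi>\<close>. Along the backward orbit the pseudo-hyperbolic steps
  converge, so near equality holds throughout; with \<open>y\<^sub>n = Im w\<^sub>n\<close> and \<open>r\<^sub>n = y\<^sub>n / y\<^sub>n\<^sub>+\<^sub>1\<close> this forces
  \<open>w\<^sub>n - w\<^sub>n\<^sub>+\<^sub>1\<close> to be asymptotically \<open>r\<^sub>n (w\<^sub>n\<^sub>+\<^sub>1 - w\<^sub>n\<^sub>+\<^sub>2)\<close>. The distances of \<open>w\<^sub>n\<close> and \<open>w\<^sub>n\<^sub>+\<^sub>2\<close> are also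
  monotone and bounded, and their limit determines that of \<open>(1 + r\<^sub>n)\<^sup>2 / r\<^sub>n\<close>. If this limit were
  not \<open>4\<close>, the heights \<open>y\<^sub>n\<close> would decay geometrically and the orbit would converge instead of
  tending to infinity.
\<close>

section \<open>The Schwarz--Pick inequality in the upper half-plane\<close>

lemma cmod_diff_cnj_sq:
  "(cmod (z - cnj w))\<^sup>2 = (cmod (z - w))\<^sup>2 + 4 * Im z * Im w"
  unfolding cmod_power2 by (simp add: power2_eq_square algebra_simps)

lemma half_plane_cayley_less_one:
  assumes "Im z > 0" "Im w > 0"
  shows "cmod ((z - w) / (z - cnj w)) < 1"
proof -
  have "z - cnj w \<noteq> 0"
    using assms by (auto simp: complex_eq_iff)
  moreover have "(cmod (z - w))\<^sup>2 < (cmod (z - cnj w))\<^sup>2"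
    using assms by (simp add: cmod_diff_cnj_sq)
  ultimately show ?thesis
    by (simp add: norm_divide power2_less_imp_less)
qed

text \<open>Cayley transforms at \<open>w\<close> and \<open>f w\<close> reduce this to the Schwarz
  lemma on the unit disc. The quotient-free form still makes sense when \<open>Im (f z)\<close> or
  \<open>Im (f w)\<close> vanishes.\<close>

lemma Schwarz_Pick_half_plane:
  assumes holf: "f holomorphic_on upper_half_plane"
    and f: "f ` upper_half_plane \<subseteq> upper_half_plane"
    and z: "Im z > 0" and w: "Im w > 0"
  shows "(cmod (f z - f w))\<^sup>2 * (Im z * Im w) \<le> (cmod (z - w))\<^sup>2 * (Im (f z) * Im (f w))"
proof -
  \<comment> \<open>\<open>c\<close> inverts the Cayley map
    \<open>z \<mapsto> (z - w) / (z - cnj w)\<close>, so \<open>c 0 = w\<close>; \<open>g\<close>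
    then sends \<open>f w\<close> to \<open>0\<close>.\<close>
  define c where "c = (\<lambda>\<zeta>. (w - cnj w * \<zeta>) / (1 - \<zeta>))"
  define g where "g = (\<lambda>\<zeta>. (f (c \<zeta>) - f w) / (f (c \<zeta>) - cnj (f w)))"
  have Imf: "Im (f u) > 0" if "Im u > 0" for u
    using f that by (auto simp: upper_half_plane_def)
  have Imc: "Im (c \<zeta>) > 0" if "cmod \<zeta> < 1" for \<zeta>
  proof -
    have ne: "1 - \<zeta> \<noteq> 0"
      using that by auto
    have "(cmod \<zeta>)\<^sup>2 < 1"
      using that by (simp add: power_less_one_iff)
    then have "Im w * (1 - (cmod \<zeta>)\<^sup>2) > 0"
      using w by simp
    moreover have "Im ((w - cnj w * \<zeta>) * cnj (1 - \<zeta>)) = Im w * (1 - (cmod \<zeta>)\<^sup>2)"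
      unfolding cmod_power2 by (simp add: power2_eq_square algebra_simps)
    ultimately show ?thesis
      using ne by (simp add: c_def Im_complex_div_gt_0)
  qed
  have "cmod (g \<zeta>) \<le> cmod \<zeta>" if "cmod \<zeta> < 1" for \<zeta>
  proof (rule Schwarz_Lemma(1)[OF _ _ _ that])
    have "c holomorphic_on ball 0 1"
      unfolding c_def by (intro holomorphic_intros) auto
    moreover have "c ` ball 0 1 \<subseteq> upper_half_plane"
      using Imc by (auto simp: upper_half_plane_def)
    ultimately have "(\<lambda>\<zeta>. f (c \<zeta>)) holomorphic_on ball 0 1"
      using holomorphic_on_compose_gen[OF _ holf] by (auto simp: o_def)
    moreover have "f (c \<zeta>) - cnj (f w) \<noteq> 0" if "\<zeta> \<in> ball 0 1" for \<zeta>
      using Imf[OF w] Imf[OF Imc[of \<zeta>]] that by (auto simp: complex_eq_iff)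
    ultimately show "g holomorphic_on ball 0 1"
      unfolding g_def by (intro holomorphic_intros) auto
    show "g 0 = 0"
      by (simp add: g_def c_def)
    show "cmod (g \<xi>) < 1" if "cmod \<xi> < 1" for \<xi>
      unfolding g_def using half_plane_cayley_less_one Imf Imc w that by blast
  qed
  moreover have "c ((z - w) / (z - cnj w)) = z"
  proof -
    have "z - cnj w \<noteq> 0" "w - cnj w \<noteq> 0"
      using z w by (auto simp: complex_eq_iff)
    then show ?thesis
      unfolding c_def by (simp add: divide_simps) (simp add: algebra_simps)
  qed
  ultimately have "cmod ((f z - f w) / (f z - cnj (f w))) \<le> cmod ((z - w) / (z - cnj w))"
    using half_plane_cayley_less_one[OF z w] unfolding g_def by metis
  moreover have "cmod (f z - cnj (f w)) > 0" "cmod (z - cnj w) > 0"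
    using z w Imf[OF z] Imf[OF w] by (auto simp: complex_eq_iff)
  ultimately have "cmod (f z - f w) * cmod (z - cnj w) \<le> cmod (z - w) * cmod (f z - cnj (f w))"
    by (simp add: norm_divide divide_simps mult.commute)
  then have "(cmod (f z - f w) * cmod (z - cnj w))\<^sup>2 \<le> (cmod (z - w) * cmod (f z - cnj (f w)))\<^sup>2"
    by (intro power_mono) auto
  \<comment> \<open>After expanding with \<open>cmod_diff_cnj_sq\<close>, the product of
    \<open>(cmod (f z - f w))\<^sup>2\<close> and \<open>(cmod (z - w))\<^sup>2\<close>
    cancels.\<close>
  then show ?thesis
    by (simp add: power_mult_distrib cmod_diff_cnj_sq algebra_simps)
qed

text \<open>Adding \<open>\<i> * \<epsilon>\<close> moves the image into the open half-plane; then
  \<epsilon> tends to 0. The intended map is \<phi> minus the identity, whose imaginary part is only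
  known to be nonnegative.\<close>

lemma Schwarz_Pick_closed_half_plane:
  assumes holf: "f holomorphic_on upper_half_plane"
    and f: "\<And>z. Im z > 0 \<Longrightarrow> Im (f z) \<ge> 0"
    and z: "Im z > 0" and w: "Im w > 0"
  shows "(cmod (f z - f w))\<^sup>2 * (Im z * Im w) \<le> (cmod (z - w))\<^sup>2 * (Im (f z) * Im (f w))"
proof (rule tendsto_lowerbound)
  let ?R = "\<lambda>\<epsilon>. (cmod (z - w))\<^sup>2 * ((Im (f z) + \<epsilon>) * (Im (f w) + \<epsilon>))"
  have "(?R \<longlongrightarrow> (cmod (z - w))\<^sup>2 * ((Im (f z) + 0) * (Im (f w) + 0))) (at_right 0)"
    by (intro tendsto_intros)
  then show "(?R \<longlongrightarrow> (cmod (z - w))\<^sup>2 * (Im (f z) * Im (f w))) (at_right 0)"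
    by simp
  show "\<forall>\<^sub>F \<epsilon> in at_right 0. (cmod (f z - f w))\<^sup>2 * (Im z * Im w) \<le> ?R \<epsilon>"
    using eventually_at_right_less
  proof eventually_elim
    case (elim \<epsilon>)
    have "(\<lambda>u. f u + \<i> * of_real \<epsilon>) holomorphic_on upper_half_plane"
      by (intro holomorphic_intros holf)
    moreover have "(\<lambda>u. f u + \<i> * of_real \<epsilon>) ` upper_half_plane \<subseteq> upper_half_plane"
      using f elim by (auto simp: upper_half_plane_def add_nonneg_pos)
    ultimately show ?case
      using Schwarz_Pick_half_plane[of "\<lambda>u. f u + \<i> * of_real \<epsilon>" z w] z w by simp
  qed
qed auto

section \<open>Julia's lemma at infinity\<close>

text \<open>Schwarz--Pick for \<open>z\<close> and \<open>\<i> * t\<close>, divided by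
  \<open>t^3\<close>, has limit \<open>Im z \<le> Im (\<phi> z)\<close> as \<open>t\<close> tends to
  infinity, because the quotient \<open>q t\<close> tends to 1.\<close>

lemma parabolic_self_map_Im_le:
  assumes \<phi>: "parabolic_self_map \<phi>" and z: "Im z > 0"
  shows "Im z \<le> Im (\<phi> z)"
proof -
  have hol: "\<phi> holomorphic_on upper_half_plane" "\<phi> ` upper_half_plane \<subseteq> upper_half_plane"
    using \<phi> by (auto simp: parabolic_self_map_def)
  \<comment> \<open>Every sector contains the positive imaginary axis, so the angle is an arbitrary
    choice.\<close>
  have "pi / 4 \<in> {0<..<pi/2}"
    using pi_gt_zero by auto
  then have lim: "((\<lambda>z. \<phi> z / z) \<longlongrightarrow> 1) (inf at_infinity (principal (sector (pi/4))))"
    using \<phi> by (auto simp: parabolic_self_map_def nontangential_limit_at_infinity_def)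
  have inf: "filterlim (\<lambda>t. \<i> * of_real t) at_infinity at_top"
    by (rule tendsto_mult_filterlim_at_infinity[OF tendsto_const _ filterlim_of_real_at_infinity]) simp
  have "Arg (\<i> * of_real t) = pi / 2" if "t > 0" for t
    using that Arg_times_of_real2[of t \<i>] by simp
  then have "\<forall>\<^sub>F t in at_top. \<i> * of_real t \<in> sector (pi/4)"
    by (intro eventually_mono[OF eventually_gt_at_top[of 0]]) (simp add: sector_def)
  with inf have "filterlim (\<lambda>t. \<i> * of_real t) (inf at_infinity (principal (sector (pi/4)))) at_top"
    by (simp add: filterlim_inf filterlim_principal)
  from filterlim_compose[OF lim this]
  have q: "((\<lambda>t. \<phi> (\<i> * of_real t) / (\<i> * of_real t)) \<longlongrightarrow> 1) at_top" .
  define q where "q = (\<lambda>t. \<phi> (\<i> * of_real t) / (\<i> * of_real t))"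
  have inv: "((\<lambda>t. c / of_real t) \<longlongrightarrow> 0) at_top" for c :: complex
    by (rule tendsto_divide_0[OF tendsto_const]) (rule filterlim_of_real_at_infinity)
  have "((\<lambda>t. (cmod (\<phi> z / of_real t - \<i> * q t))\<^sup>2 * Im z) \<longlongrightarrow> (cmod (0 - \<i> * 1))\<^sup>2 * Im z) at_top"
    by (intro tendsto_intros inv q[folded q_def])
  moreover have "((\<lambda>t. (cmod (z / of_real t - \<i>))\<^sup>2 * (Im (\<phi> z) * Im (\<i> * q t)))
      \<longlongrightarrow> (cmod (0 - \<i>))\<^sup>2 * (Im (\<phi> z) * Im (\<i> * 1))) at_top"
    by (intro tendsto_intros inv q[folded q_def])
  moreover have "\<forall>\<^sub>F t in at_top. (cmod (\<phi> z / of_real t - \<i> * q t))\<^sup>2 * Im z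
      \<le> (cmod (z / of_real t - \<i>))\<^sup>2 * (Im (\<phi> z) * Im (\<i> * q t))"
    using eventually_gt_at_top[of 0]
  proof eventually_elim
    case (elim t)
    have *: "\<phi> (\<i> * of_real t) = of_real t * (\<i> * q t)"
      using elim by (simp add: q_def)
    have "\<phi> z - \<phi> (\<i> * of_real t) = of_real t * (\<phi> z / of_real t - \<i> * q t)"
      using elim by (simp add: * algebra_simps)
    then have 1: "(cmod (\<phi> z - \<phi> (\<i> * of_real t)))\<^sup>2 = t\<^sup>2 * (cmod (\<phi> z / of_real t - \<i> * q t))\<^sup>2"
      using elim by (simp only: norm_mult power_mult_distrib) simp
    have "z - \<i> * of_real t = of_real t * (z / of_real t - \<i>)"
      using elim by (simp add: algebra_simps)
    then have 2: "(cmod (z - \<i> * of_real t))\<^sup>2 = t\<^sup>2 * (cmod (z / of_real t - \<i>))\<^sup>2"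
      using elim by (simp only: norm_mult power_mult_distrib) simp
    have 3: "Im (\<phi> (\<i> * of_real t)) = t * Im (\<i> * q t)"
      by (simp add: *)
    have "t^3 * ((cmod (\<phi> z / of_real t - \<i> * q t))\<^sup>2 * Im z)
       \<le> t^3 * ((cmod (z / of_real t - \<i>))\<^sup>2 * (Im (\<phi> z) * Im (\<i> * q t)))"
      using Schwarz_Pick_half_plane[OF hol z, of "\<i> * of_real t"] elim
      unfolding 1 2 3 by (simp add: power2_eq_square power3_eq_cube mult_ac)
    then show ?case
      using elim by (simp only: mult_le_cancel_left_pos zero_less_power)
  qed
  ultimately show ?thesis
    using tendsto_le[of at_top] by force
qed

section \<open>Near equality in the Cauchy--Schwarz step\<close>

text \<open>
  If equality almost holds in the Schwarz--Pick inequality for \<open>\<phi>\<close>, then it almost holds in the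
  Cauchy--Schwarz step that derives it from the inequality for \<open>\<phi> - id\<close>. Here \<open>e\<close> is a difference
  quotient of \<open>\<phi> - id\<close>, and \<open>\<alpha>\<close>, \<open>\<beta>\<close> are the values of \<open>Im (\<phi> z - z) / Im z\<close> at its two nodes.
\<close>

lemma near_equality_estimates:
  fixes e :: complex and \<alpha> \<beta> \<theta> :: real
  assumes "\<alpha> \<ge> 0" "\<beta> \<ge> 0"
    and e: "(cmod e)\<^sup>2 \<le> \<alpha> * \<beta>"
    and lower: "(1 + \<alpha>) * (1 + \<beta>) - \<theta> \<le> (cmod (1 + e))\<^sup>2"
  shows "(sqrt \<alpha> - sqrt \<beta>)\<^sup>2 \<le> \<theta>"
    and "\<bar>sqrt (\<alpha> * \<beta>) - Re e\<bar> \<le> \<theta>"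
    and "\<bar>\<alpha> * \<beta> - (cmod e)\<^sup>2\<bar> \<le> \<theta>"
proof -
  define x where "x = sqrt (\<alpha> * \<beta>)"
  have "cmod e \<le> x"
    using e by (simp add: x_def real_le_rsqrt)
  then have Re: "Re e \<le> x"
    using complex_Re_le_cmod order_trans by blast
  have sq: "(sqrt \<alpha> - sqrt \<beta>)\<^sup>2 = \<alpha> + \<beta> - 2 * x"
    using assms by (simp add: power2_diff x_def real_sqrt_mult)
  have "(cmod (1 + e))\<^sup>2 = 1 + 2 * Re e + (cmod e)\<^sup>2"
    unfolding cmod_power2 by (simp add: power2_eq_square algebra_simps)
  \<comment> \<open>The deficit
    \<open>(1 + \<alpha>) * (1 + \<beta>) - (cmod (1 + e))\<^sup>2\<close> is a sum of three
    nonnegative terms, so \<theta> bounds each of them.\<close>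
  with lower have total: "(sqrt \<alpha> - sqrt \<beta>)\<^sup>2 + 2 * (x - Re e) + (\<alpha> * \<beta> - (cmod e)\<^sup>2) \<le> \<theta>"
    unfolding sq by (simp add: algebra_simps)
  have "u \<le> \<theta> \<and> \<bar>p\<bar> \<le> \<theta> \<and> \<bar>q\<bar> \<le> \<theta>"
    if "u + 2 * p + q \<le> \<theta>" "0 \<le> u" "0 \<le> p" "0 \<le> q" for u p q :: real
    using that by linarith
  from this[OF total] Re e
  show "(sqrt \<alpha> - sqrt \<beta>)\<^sup>2 \<le> \<theta>" "\<bar>sqrt (\<alpha> * \<beta>) - Re e\<bar> \<le> \<theta>"
      "\<bar>\<alpha> * \<beta> - (cmod e)\<^sup>2\<bar> \<le> \<theta>"
    by (simp_all add: x_def)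
qed

section \<open>Step quotients and summable orbits\<close>

text \<open>Turns the limit of the pseudo-hyperbolic steps into a limit of the quotients that occur
  in the Schwarz--Pick inequality.\<close>

lemma cmod_sq_div_Im_conv_phyp_dist:
  assumes "Im z > 0" "Im w > 0"
  shows "(cmod (z - w))\<^sup>2 / (Im z * Im w) = 4 * (phyp_dist z w)\<^sup>2 / (1 - (phyp_dist z w)\<^sup>2)"
proof -
  define m where "m = (cmod (z - w))\<^sup>2"
  define k where "k = Im z * Im w"
  have "m \<ge> 0" "k > 0"
    using assms by (simp_all add: m_def k_def)
  have "(phyp_dist z w)\<^sup>2 = (cmod (w - z))\<^sup>2 / (cmod (w - cnj z))\<^sup>2"
    by (simp add: phyp_dist_def norm_divide power_divide)
  also have "\<dots> = m / (m + 4 * k)"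
    by (simp add: cmod_diff_cnj_sq m_def k_def norm_minus_commute mult_ac)
  finally have d: "(phyp_dist z w)\<^sup>2 = m / (m + 4 * k)" .
  show ?thesis
    using \<open>m \<ge> 0\<close> \<open>k > 0\<close> unfolding d m_def[symmetric] k_def[symmetric]
    by (simp add: divide_simps)
qed

text \<open>The ratio test makes \<open>y\<close> summable, so the increments of \<open>w\<close>
  are absolutely summable and telescope.\<close>

lemma convergent_of_geometric_steps:
  fixes w :: "nat \<Rightarrow> 'a::banach" and y :: "nat \<Rightarrow> real"
  assumes "q < 1" "\<And>n. y n > 0"
    and step: "\<forall>\<^sub>F n in sequentially. y (Suc n) \<le> q * y n"
    and w: "\<And>n. norm (w (Suc n) - w n) \<le> C * y n"
  shows "convergent w"
proof -
  obtain N where N: "\<And>n. n \<ge> N \<Longrightarrow> y (Suc n) \<le> q * y n"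
    using step by (auto simp: eventually_sequentially)
  have "norm (y (Suc n)) \<le> q * norm (y n)" if "n \<ge> N" for n
    using N[OF that] assms(2)[of n] assms(2)[of "Suc n"] by simp
  then have "summable y"
    using summable_ratio_test[OF \<open>q < 1\<close>] by blast
  then have "summable (\<lambda>n. C * y n)"
    by (rule summable_mult)
  then have "summable (\<lambda>n. w (Suc n) - w n)"
    by (rule summable_comparison_test'[where N = 0]) (use w in auto)
  then have "convergent (\<lambda>n. \<Sum>i<n. w (Suc i) - w i)"
    by (simp add: summable_iff_convergent)
  then have "convergent (\<lambda>n. (w n - w 0) + w 0)"
    unfolding sum_lessThan_telescope by (intro convergent_add convergent_const)
  then show ?thesis
    by simp
qed

section \<open>Monotone quantities along the backward orbit\<close>

theorem theorem1p11:
  fixes \<phi> :: "complex \<Rightarrow> complex" and w :: "nat \<Rightarrow> complex" and a :: real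
  assumes "parabolic_self_map \<phi>"
    and "backward_iteration_sequence \<phi> w"
    and "incseq (\<lambda>n. phyp_dist (w n) (w (Suc n)))"
    and "(\<lambda>n. phyp_dist (w n) (w (Suc n))) \<longlonglongrightarrow> a"
    and "a < 1"
    and "filterlim w at_infinity sequentially"
  shows "(\<lambda>n. Im (w (Suc n)) / Im (w n)) \<longlonglongrightarrow> 1"
proof -
  define y where "y n = Im (w n)" for n
  define r where "r n = y n / y (Suc n)" for n
  define D where "D n = w n - w (Suc n)" for n
  \<comment> \<open>\<open>S\<close> and \<open>V\<close> are the Schwarz--Pick quotients of the
    pairs at index distance one and two; both are nondecreasing, since \<phi> shifts indices
    down.\<close>
  define S where "S n = (cmod (D n))\<^sup>2 / (y n * y (Suc n))" for n
  define V where "V n = (cmod (D n + D (Suc n)))\<^sup>2 / (y n * y (Suc (Suc n)))" for n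
  define s where "s = 4 * a\<^sup>2 / (1 - a\<^sup>2)"

  have hol: "\<phi> holomorphic_on upper_half_plane" "\<phi> ` upper_half_plane \<subseteq> upper_half_plane"
    using assms(1) by (auto simp: parabolic_self_map_def)
  have y: "y n > 0" "Im (w n) > 0" and \<phi>w: "\<phi> (w (Suc n)) = w n" for n
    using assms(2) by (auto simp: backward_iteration_sequence_def upper_half_plane_def y_def)
  have y_dec: "y (Suc n) \<le> y n" for n
    using parabolic_self_map_Im_le[OF assms(1) y(2)[of "Suc n"]] by (simp add: \<phi>w y_def)
  have r: "r n \<ge> 1" for n
    using y_dec y by (simp add: r_def)

  have not_conv: "\<not> convergent w"
    using assms(6) not_tendsto_and_filterlim_at_infinity[OF sequentially_bot]
    by (auto simp: convergent_def)

  have dn_le: "phyp_dist (w n) (w (Suc n)) \<le> a" for n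
    using incseq_le[OF assms(3,4)] .
  \<comment> \<open>A constant orbit would converge. Hence \<open>a > 0\<close> and
    \<open>s > 0\<close>, which later allows division by \<open>s\<close> and, eventually, by
    \<open>S (Suc n)\<close>.\<close>
  have "\<exists>n. w (Suc n) \<noteq> w n"
  proof (rule ccontr)
    assume "\<not> ?thesis"
    then have "w n = w 0" for n
      by (induction n) auto
    then have "w = (\<lambda>_. w 0)"
      by blast
    then show False
      using not_conv convergent_const by metis
  qed
  then obtain n0 where "w (Suc n0) \<noteq> w n0" ..
  moreover have "w (Suc n0) - cnj (w n0) \<noteq> 0"
    using y(2)[of n0] y(2)[of "Suc n0"] by (auto simp: complex_eq_iff)
  ultimately have "phyp_dist (w n0) (w (Suc n0)) > 0"
    by (simp add: phyp_dist_def)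
  then have a: "a > 0"
    using dn_le[of n0] by linarith
  then have a2: "a\<^sup>2 < 1"
    using assms(5) by (simp add: power_less_one_iff)
  have s: "s > 0"
    using a a2 by (simp add: s_def)
  have S_lim: "S \<longlonglongrightarrow> s"
  proof -
    have "S = (\<lambda>n. 4 * (phyp_dist (w n) (w (Suc n)))\<^sup>2 / (1 - (phyp_dist (w n) (w (Suc n)))\<^sup>2))"
      unfolding S_def D_def y_def using y(2) by (simp add: cmod_sq_div_Im_conv_phyp_dist)
    then show ?thesis
      unfolding s_def using a2 by (auto intro!: tendsto_eq_intros assms(4))
  qed

  have SP: "(cmod (w m - w n))\<^sup>2 / (y m * y n)
      \<le> (cmod (w (Suc m) - w (Suc n)))\<^sup>2 / (y (Suc m) * y (Suc n))" for m n
    using Schwarz_Pick_half_plane[OF hol y(2)[of "Suc m"] y(2)[of "Suc n"]] y(1)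
    unfolding \<phi>w y_def[symmetric] by (simp add: divide_simps mult_ac)
  have S_inc: "incseq S"
    by (rule incseq_SucI) (use SP in \<open>simp add: S_def D_def\<close>)
  have S_le: "S n \<le> s" for n
    using incseq_le[OF S_inc S_lim] .
  have V_inc: "incseq V"
    by (rule incseq_SucI) (use SP in \<open>simp add: V_def D_def\<close>)
  have D_sq: "(cmod (D n))\<^sup>2 = S n * (y n * y (Suc n))" for n
    using y(1)[of n] y(1)[of "Suc n"] by (simp add: S_def)

  \<comment> \<open>The vertical part of a step is at most its length, so
    \<open>(r n - 1)\<^sup>2 \<le> s * r n\<close>. This bound keeps the error terms below under
    control.\<close>
  have r_bound: "r n \<le> s + 2" for n
  proof -
    have "(y n - y (Suc n))\<^sup>2 \<le> (cmod (D n))\<^sup>2"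
      using abs_Im_le_cmod[of "D n"] by (simp add: D_def y_def abs_le_square_iff[symmetric])
    also have "\<dots> \<le> s * (y n * y (Suc n))"
      unfolding D_sq using S_le y by (intro mult_right_mono) (auto simp: less_imp_le)
    finally have "(y n - y (Suc n))\<^sup>2 / (y (Suc n))\<^sup>2 \<le> s * (y n * y (Suc n)) / (y (Suc n))\<^sup>2"
      by (intro divide_right_mono) auto
    then have "(r n - 1)\<^sup>2 \<le> s * r n"
      using y[of "Suc n"] by (simp add: r_def power2_eq_square field_simps)
    then have "r n * (r n - 2 - s) \<le> 0"
      by (simp add: power2_eq_square algebra_simps)
    then show ?thesis
      using r[of n] by (simp add: mult_le_0_iff)
  qed

  \<comment> \<open>Near equality along the orbit\<close>
  \<comment> \<open>\<open>e n\<close> is the difference quotient of \<phi> minus the identity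
    between \<open>w (Suc n)\<close> and \<open>w (Suc (Suc n))\<close>; \<open>\<alpha> n\<close>
    is \<open>Im (\<phi> z - z) / Im z\<close> at \<open>z = w (Suc n)\<close>. In
    \<open>\<theta> n\<close>, the factor \<open>(s + 2) * (s + 2)\<close> bounds
    \<open>r n * r (Suc n)\<close>.\<close>
  define e where "e n = D n / D (Suc n) - 1" for n
  define \<alpha> where "\<alpha> n = r n - 1" for n
  define \<theta> where "\<theta> n = (S (Suc n) - S n) / S (Suc n) * ((s + 2) * (s + 2))" for n
  have \<alpha>: "\<alpha> n \<ge> 0" "\<alpha> n \<le> s + 1" for n
    using r[of n] r_bound[of n] by (simp_all add: \<alpha>_def)

  have \<theta>_lim: "\<theta> \<longlonglongrightarrow> 0"
    unfolding \<theta>_def using s by (auto intro!: tendsto_eq_intros S_lim LIMSEQ_Suc[OF S_lim])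

  have ev: "\<forall>\<^sub>F n in sequentially. S (Suc n) > 0"
    using order_tendstoD(1)[OF LIMSEQ_Suc[OF S_lim] s] .
  have est: "\<forall>\<^sub>F n in sequentially. (cmod (e n))\<^sup>2 \<le> \<alpha> n * \<alpha> (Suc n)
      \<and> (1 + \<alpha> n) * (1 + \<alpha> (Suc n)) - \<theta> n \<le> (cmod (1 + e n))\<^sup>2
      \<and> V n = (cmod (2 + e n))\<^sup>2 * S (Suc n) / r n"
    using ev
  proof eventually_elim
    case (elim n)
    have D1: "D (Suc n) \<noteq> 0"
      using elim by (auto simp: S_def)
    have Dn: "D n = (1 + e n) * D (Suc n)"
      using D1 by (simp add: e_def)
    have "(\<lambda>z. \<phi> z - z) holomorphic_on upper_half_plane"
      by (intro holomorphic_intros hol)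
    from Schwarz_Pick_closed_half_plane[OF this _ y(2)[of "Suc n"] y(2)[of "Suc (Suc n)"]]
    have "(cmod (D n - D (Suc n)))\<^sup>2 * (y (Suc n) * y (Suc (Suc n)))
        \<le> (cmod (D (Suc n)))\<^sup>2 * ((y n - y (Suc n)) * (y (Suc n) - y (Suc (Suc n))))"
      using parabolic_self_map_Im_le[OF assms(1)] by (simp add: \<phi>w D_def y_def algebra_simps)
    moreover have "D n - D (Suc n) = e n * D (Suc n)"
      by (simp add: Dn algebra_simps)
    ultimately have "(cmod (D (Suc n)))\<^sup>2 * ((cmod (e n))\<^sup>2 * (y (Suc n) * y (Suc (Suc n))))
        \<le> (cmod (D (Suc n)))\<^sup>2 * ((y n - y (Suc n)) * (y (Suc n) - y (Suc (Suc n))))"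
      by (simp add: norm_mult power_mult_distrib mult_ac)
    then have "(cmod (e n))\<^sup>2 * (y (Suc n) * y (Suc (Suc n)))
        \<le> (y n - y (Suc n)) * (y (Suc n) - y (Suc (Suc n)))"
      using D1 by (simp add: mult_le_cancel_left_pos)
    moreover have "\<dots> = \<alpha> n * \<alpha> (Suc n) * (y (Suc n) * y (Suc (Suc n)))"
      using y(1)[of "Suc n"] y(1)[of "Suc (Suc n)"] by (simp add: \<alpha>_def r_def field_simps)
    ultimately have 1: "(cmod (e n))\<^sup>2 \<le> \<alpha> n * \<alpha> (Suc n)"
      using y(1)[of "Suc n"] y(1)[of "Suc (Suc n)"] by (simp add: mult_le_cancel_right_pos)

    have yr: "y (Suc n) = y (Suc (Suc n)) * r (Suc n)" "y n = y (Suc (Suc n)) * r (Suc n) * r n"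
      using y(1)[of "Suc n"] y(1)[of "Suc (Suc n)"] by (simp_all add: r_def)
    \<comment> \<open>Two expressions for \<open>(cmod (D n))\<^sup>2\<close>: the relative growth
      of \<open>S\<close> measures how far \<open>(cmod (1 + e n))\<^sup>2\<close> falls short of
      \<open>r n * r (Suc n)\<close>.\<close>
    have "S n * (y n * y (Suc n)) = (cmod (1 + e n))\<^sup>2 * (S (Suc n) * (y (Suc n) * y (Suc (Suc n))))"
      unfolding D_sq[symmetric] by (simp add: Dn norm_mult power_mult_distrib)
    then have "(cmod (1 + e n))\<^sup>2 * S (Suc n) = S n * (r n * r (Suc n))"
      using y(1)[of "Suc (Suc n)"] r[of "Suc n"] unfolding yr by (simp add: mult_ac)
    then have "(cmod (1 + e n))\<^sup>2 = r n * r (Suc n) - (S (Suc n) - S n) / S (Suc n) * (r n * r (Suc n))"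
      using elim by (simp add: field_simps)
    moreover have "(S (Suc n) - S n) / S (Suc n) * (r n * r (Suc n)) \<le> \<theta> n"
      unfolding \<theta>_def using elim incseq_SucD[OF S_inc, of n] r_bound r[of n] r[of "Suc n"] s
      by (intro mult_left_mono mult_mono) auto
    ultimately have 2: "(1 + \<alpha> n) * (1 + \<alpha> (Suc n)) - \<theta> n \<le> (cmod (1 + e n))\<^sup>2"
      by (simp add: \<alpha>_def)

    have "D n + D (Suc n) = (2 + e n) * D (Suc n)"
      by (simp add: Dn algebra_simps)
    then have "V n = (cmod (2 + e n))\<^sup>2 * (S (Suc n) * (y (Suc n) * y (Suc (Suc n)))) / (y n * y (Suc (Suc n)))"
      unfolding D_sq[symmetric] by (simp add: V_def norm_mult power_mult_distrib)
    then have 3: "V n = (cmod (2 + e n))\<^sup>2 * S (Suc n) / r n"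
      using y(1)[of "Suc (Suc n)"] r[of "Suc n"] r[of n] unfolding yr by simp
    show ?case
      using 1 2 3 by blast
  qed

  define x where "x n = sqrt (\<alpha> n * \<alpha> (Suc n))" for n
  have near: "\<forall>\<^sub>F n in sequentially. (sqrt (\<alpha> n) - sqrt (\<alpha> (Suc n)))\<^sup>2 \<le> \<theta> n
      \<and> \<bar>x n - Re (e n)\<bar> \<le> \<theta> n \<and> \<bar>\<alpha> n * \<alpha> (Suc n) - (cmod (e n))\<^sup>2\<bar> \<le> \<theta> n"
    using est
  proof eventually_elim
    case (elim n)
    show ?case
      using near_equality_estimates[OF \<alpha>(1)[of n] \<alpha>(1)[of "Suc n"]] elim unfolding x_def by blast
  qed
  have lim1: "(\<lambda>n. sqrt (\<alpha> n) - sqrt (\<alpha> (Suc n))) \<longlonglongrightarrow> 0"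
  proof -
    have "(\<lambda>n. (sqrt (\<alpha> n) - sqrt (\<alpha> (Suc n)))\<^sup>2) \<longlonglongrightarrow> 0"
      by (rule tendsto_sandwich[OF _ _ tendsto_const \<theta>_lim])
        (use near in \<open>auto elim: eventually_mono\<close>)
    then show ?thesis
      by simp
  qed
  have lim2: "(\<lambda>n. x n - Re (e n)) \<longlonglongrightarrow> 0"
    by (rule Lim_null_comparison[OF _ \<theta>_lim]) (use near in \<open>auto elim: eventually_mono\<close>)
  have lim3: "(\<lambda>n. \<alpha> n * \<alpha> (Suc n) - (cmod (e n))\<^sup>2) \<longlonglongrightarrow> 0"
    by (rule Lim_null_comparison[OF _ \<theta>_lim]) (use near in \<open>auto elim: eventually_mono\<close>)
  have bdd: "\<forall>\<^sub>F n in sequentially. norm (sqrt (\<alpha> n)) \<le> sqrt (s + 1)"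
    using \<alpha> by simp
  have lim4: "(\<lambda>n. x n - \<alpha> n) \<longlonglongrightarrow> 0"
  proof -
    have "x n - \<alpha> n = - (sqrt (\<alpha> n) * (sqrt (\<alpha> n) - sqrt (\<alpha> (Suc n))))" for n
      using \<alpha>(1)[of n] by (simp add: x_def real_sqrt_mult algebra_simps)
    then show ?thesis
      using tendsto_minus[OF lim_null_mult_left_bounded[OF bdd lim1]] by simp
  qed
  \<comment> \<open>\<open>E\<close> compares \<open>e n\<close> with \<open>\<alpha> n\<close>, as
    \<open>1 + r n = 2 + \<alpha> n\<close>. By \<open>lim2\<close> and \<open>lim3\<close>,
    \<open>(cmod (2 + e n))\<^sup>2\<close> is close to \<open>(2 + x n)\<^sup>2\<close>, and
    \<open>lim4\<close> replaces \<open>x n\<close> by \<open>\<alpha> n\<close>.\<close>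
  define E where "E n = (cmod (2 + e n))\<^sup>2 - (1 + r n)\<^sup>2" for n
  have E_lim: "E \<longlonglongrightarrow> 0"
  proof -
    have E_eq: "E = (\<lambda>n. (4 + x n + \<alpha> n) * (x n - \<alpha> n)
        - (4 * (x n - Re (e n)) + (\<alpha> n * \<alpha> (Suc n) - (cmod (e n))\<^sup>2)))"
    proof
      fix n
      have "(x n)\<^sup>2 = \<alpha> n * \<alpha> (Suc n)"
        using \<alpha> by (simp add: x_def)
      moreover have "(cmod (2 + e n))\<^sup>2 = 4 + 4 * Re (e n) + (cmod (e n))\<^sup>2"
        unfolding cmod_power2 by (simp add: power2_eq_square algebra_simps)
      ultimately show "E n = (4 + x n + \<alpha> n) * (x n - \<alpha> n)
          - (4 * (x n - Re (e n)) + (\<alpha> n * \<alpha> (Suc n) - (cmod (e n))\<^sup>2))"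
        by (simp add: E_def \<alpha>_def power2_eq_square algebra_simps)
    qed
    have "norm (4 + x n + \<alpha> n) \<le> 2 * s + 6" for n
    proof -
      have "x n \<le> s + 1"
        unfolding x_def using \<alpha> s
        by (intro real_le_lsqrt) (auto simp: power2_eq_square intro: mult_mono)
      moreover have "x n \<ge> 0"
        using \<alpha> by (simp add: x_def)
      ultimately show ?thesis
        using \<alpha>[of n] by simp
    qed
    then have "(\<lambda>n. (4 + x n + \<alpha> n) * (x n - \<alpha> n)) \<longlonglongrightarrow> 0"
      by (intro lim_null_mult_left_bounded[OF always_eventually lim4] allI)
    from tendsto_diff[OF this tendsto_add[OF tendsto_mult_right_zero[OF lim2, of 4] lim3]]
    show ?thesis
      unfolding E_eq by simp
  qed

  \<comment> \<open>Second neighbours and the limit of the height ratios\<close>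
  have "\<exists>v. V \<longlonglongrightarrow> v"
  proof -
    have "\<forall>\<^sub>F n in sequentially. \<bar>V n\<bar> \<le> (1 + (s + 3)\<^sup>2) * s"
      using est ev order_tendstoD(2)[OF E_lim zero_less_one]
    proof eventually_elim
      case (elim n)
      have "(1 + r n)\<^sup>2 \<le> (s + 3)\<^sup>2"
        using r[of n] r_bound[of n] by (intro power_mono) auto
      then have "(cmod (2 + e n))\<^sup>2 \<le> 1 + (s + 3)\<^sup>2"
        using elim by (simp add: E_def)
      then have "(cmod (2 + e n))\<^sup>2 * S (Suc n) \<le> (1 + (s + 3)\<^sup>2) * s"
        using S_le elim by (intro mult_mono) auto
      moreover have "V n \<le> (cmod (2 + e n))\<^sup>2 * S (Suc n) / 1"
        using elim r[of n] by (simp only:) (intro divide_left_mono, auto)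
      moreover have "V n \<ge> 0"
        using elim r[of n] by simp
      ultimately show ?case
        by simp
    qed
    then have "Bseq V"
      by (auto intro: BfunI)
    with V_inc show ?thesis
      using Bseq_mono_convergent[of V] by (auto simp: convergent_def incseq_def)
  qed
  then obtain v where V_lim: "V \<longlonglongrightarrow> v" ..
  \<comment> \<open>\<open>h n\<close> equals \<open>(1 + r n)\<^sup>2 / r n - 4\<close>, while
    \<open>V n / S (Suc n)\<close> is eventually \<open>(1 + r n)\<^sup>2 / r n + E n / r n\<close>;
    hence the limit \<open>v / s - 4\<close>.\<close>
  define h where "h n = (r n - 1)\<^sup>2 / r n" for n
  define l where "l = v / s - 4"
  have h_lim: "h \<longlonglongrightarrow> l"
  proof -
    have "norm (inverse (r n)) \<le> 1" for n
      using r[of n] by (simp add: inverse_le_1_iff)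
    then have "(\<lambda>n. inverse (r n) * E n) \<longlonglongrightarrow> 0"
      by (intro lim_null_mult_left_bounded[OF always_eventually E_lim] allI)
    then have "(\<lambda>n. E n / r n) \<longlonglongrightarrow> 0"
      by (simp add: divide_inverse mult.commute)
    then have "(\<lambda>n. V n / S (Suc n) - E n / r n - 4) \<longlonglongrightarrow> v / s - 0 - 4"
      using s by (intro tendsto_intros V_lim LIMSEQ_Suc[OF S_lim]) auto
    moreover have "\<forall>\<^sub>F n in sequentially. V n / S (Suc n) - E n / r n - 4 = h n"
      using est ev
    proof eventually_elim
      case (elim n)
      then show ?case
        using r[of n] by (simp add: h_def E_def field_simps power2_eq_square)
    qed
    ultimately show ?thesis
      unfolding l_def using Lim_transform_eventually by force
  qed
  have h_nonneg: "h n \<ge> 0" for n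
    using r[of n] by (simp add: h_def)
  then have "l \<ge> 0"
    by (intro tendsto_lowerbound[OF h_lim]) auto
  have "l = 0"
  proof (rule ccontr)
    assume "l \<noteq> 0"
    then have "l > 0"
      using \<open>l \<ge> 0\<close> by simp
    \<comment> \<open>Once \<open>h n > l / 2\<close>, \<open>r n \<ge> 1\<close> gives
      \<open>(r n - 1)\<^sup>2 \<ge> l / 2\<close>, that is \<open>r n \<ge> q\<close>. The heights
      then decay by the factor \<open>1 / q\<close>, and steps of size at most
      \<open>sqrt s * y n\<close> force convergence.\<close>
    define q where "q = 1 + sqrt (l / 2)"
    have q: "q > 1"
      using \<open>l > 0\<close> by (simp add: q_def)
    have "\<forall>\<^sub>F n in sequentially. h n > l / 2"
      using \<open>l > 0\<close> by (intro order_tendstoD(1)[OF h_lim]) simp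
    then have "\<forall>\<^sub>F n in sequentially. y (Suc n) \<le> 1 / q * y n"
    proof eventually_elim
      case (elim n)
      have "l / 2 \<le> l / 2 * r n"
        using r[of n] \<open>l > 0\<close> by simp
      also have "\<dots> \<le> (r n - 1)\<^sup>2"
        using elim r[of n] by (simp add: h_def field_simps)
      finally have "sqrt (l / 2) \<le> r n - 1"
        using r[of n] by (intro real_le_lsqrt) auto
      then have "q \<le> r n"
        by (simp add: q_def)
      then show ?case
        using y(1)[of "Suc n"] q by (simp add: r_def field_simps)
    qed
    moreover have "norm (w (Suc n) - w n) \<le> sqrt s * y n" for n
    proof -
      have "(cmod (D n))\<^sup>2 \<le> s * (y n)\<^sup>2"
        unfolding D_sq power2_eq_square[of "y n"] using S_le y_dec y s by (intro mult_mono) (auto simp: less_imp_le)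
      then have "cmod (D n) \<le> sqrt (s * (y n)\<^sup>2)"
        by (rule real_le_rsqrt)
      then show ?thesis
        using y(1)[of n] by (simp add: D_def norm_minus_commute real_sqrt_mult)
    qed
    ultimately have "convergent w"
      using convergent_of_geometric_steps[of "1 / q" y w "sqrt s"] q y(1) by simp
    with not_conv show False ..
  qed
  \<comment> \<open>\<open>(r n - 1)\<^sup>2 = r n * h n\<close>, and \<open>r n\<close> is at most
    \<open>s + 2\<close>.\<close>
  have "(\<lambda>n. (s + 2) * h n) \<longlonglongrightarrow> 0"
    using tendsto_mult_right_zero[of h sequentially "s + 2"] h_lim \<open>l = 0\<close> by simp
  then have "(\<lambda>n. (r n - 1)\<^sup>2) \<longlonglongrightarrow> 0"
  proof (rule Lim_null_comparison[rotated], intro always_eventually allI)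
    fix n
    have "(r n - 1)\<^sup>2 = r n * h n"
      using r[of n] by (simp add: h_def)
    then show "norm ((r n - 1)\<^sup>2) \<le> (s + 2) * h n"
      using r_bound[of n] r[of n] h_nonneg[of n] by (simp add: mult_right_mono abs_mult)
  qed
  then have "(\<lambda>n. r n - 1) \<longlonglongrightarrow> 0"
    by simp
  then have "r \<longlonglongrightarrow> 1"
    by (simp add: LIM_zero_iff)
  then have "(\<lambda>n. inverse (r n)) \<longlonglongrightarrow> inverse 1"
    by (rule tendsto_inverse) simp
  then show ?thesis
    by (simp add: r_def y_def)
qed

end
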